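(* Let $\rho_{m,p}$ denote the number of rectangular gapless shapes with $p$ rows and $m$ columns. Define a sequence of integers by $\alpha_1=1$, $\alpha_2=2$, $\alpha_3=6$, $\alpha_4=26$ and $$\alpha_n=\rho_{\lceil n/2\rceil,\lfloor n/2\rfloor}\,\alpha_{\lceil n/2\rceil}\qquad (n\ge 5).$$ Then for every $n\ge 1$ the number of gapless shapes of size $n$ is greater than $\alpha_n$.
   Context: A rectangular gapless shape with $p$ rows and $m$ columns is an array $(r_{i,j})_{1\le i\le p,\,1\le j\le m}$ of 0's and 1's such that for all $1\le j<m$ and $1\le i\le p$, $\sum_{k=i}^p r_{k,j}\le\sum_{k=i}^p r_{k,j+1}$. A monotone triangle of size $N$ is an array $(a_{i,j})$ of positive integers, defined for $N\ge i\ge j\ge 1$, such that $a_{i,j}<a_{i,j+1}$, $a_{i,j}\le a_{i-1,j}$ and $a_{i,j}\le a_{i+1,j+1}$ whenever both sides are defined, and $a_{N,j}=j$ for all $j$. It is gapless if $a_{i,j}-a_{i+1,j}\le 1$ for all $1\le j\le i<N$. The shape of a gapless monotone triangle of size $N$ is the triangular array of size $N-1$ with entries $s_{i,j}=a_{i,j}-a_{i+1,j}\in\{0,1\}$ for $1\le j\le i\le N-1$. A gapless shape of size $n$ is a triangular array $(s_{i,j})_{1\le j\le i\le n}$ that is the shape of some gapless monotone triangle of size $n+1$. *)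

theory Defs
  imports "HOL-Library.FuncSet"
begin

text \<open>
  Arrays are integer-valued functions on pairs \<open>(row, column)\<close>, extensional on their
  (1-based) index set, so that counting functions counts arrays.
\<close>

definition rect_gapless_shapes :: "nat \<Rightarrow> nat \<Rightarrow> (nat \<times> nat \<Rightarrow> int) set" where
  "rect_gapless_shapes m p =
     {r \<in> {1..p} \<times> {1..m} \<rightarrow>\<^sub>E {0, 1}.
        \<forall>i j. 1 \<le> i \<and> i \<le> p \<and> 1 \<le> j \<and> j < m \<longrightarrow>
          (\<Sum>k = i..p. r (k, j)) \<le> (\<Sum>k = i..p. r (k, j + 1))}"

text \<open>The first argument is the number of columns, the second the number of rows.\<close>

definition rho :: "nat \<Rightarrow> nat \<Rightarrow> nat" where
  "rho m p = card (rect_gapless_shapes m p)"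

definition tri :: "nat \<Rightarrow> (nat \<times> nat) set" where
  "tri N = {(i, j). 1 \<le> j \<and> j \<le> i \<and> i \<le> N}"

definition monotone_triangles :: "nat \<Rightarrow> (nat \<times> nat \<Rightarrow> int) set" where
  "monotone_triangles N =
     {a \<in> tri N \<rightarrow>\<^sub>E {1..}.
        (\<forall>i j. (i, j) \<in> tri N \<and> (i, j + 1) \<in> tri N \<longrightarrow> a (i, j) < a (i, j + 1)) \<and>
        (\<forall>i j. (i, j) \<in> tri N \<and> (i - 1, j) \<in> tri N \<longrightarrow> a (i, j) \<le> a (i - 1, j)) \<and>
        (\<forall>i j. (i, j) \<in> tri N \<and> (i + 1, j + 1) \<in> tri N \<longrightarrow> a (i, j) \<le> a (i + 1, j + 1)) \<and>
        (\<forall>j. 1 \<le> j \<and> j \<le> N \<longrightarrow> a (N, j) = int j)}"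

definition gapless_monotone_triangles :: "nat \<Rightarrow> (nat \<times> nat \<Rightarrow> int) set" where
  "gapless_monotone_triangles N =
     {a \<in> monotone_triangles N.
        \<forall>i j. 1 \<le> j \<and> j \<le> i \<and> i < N \<longrightarrow> a (i, j) - a (i + 1, j) \<le> 1}"

definition shape :: "nat \<Rightarrow> (nat \<times> nat \<Rightarrow> int) \<Rightarrow> (nat \<times> nat \<Rightarrow> int)" where
  "shape N a = (\<lambda>(i, j) \<in> tri (N - 1). a (i, j) - a (i + 1, j))"

definition gapless_shapes :: "nat \<Rightarrow> (nat \<times> nat \<Rightarrow> int) set" where
  "gapless_shapes n = shape (n + 1) ` gapless_monotone_triangles (n + 1)"

text \<open>
  \<open>(n + 1) div 2\<close> and \<open>n div 2\<close> are the upper and lower integer parts of \<open>n / 2\<close>.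
  The sequence starts at index 1; the value at 0 is a dummy.
\<close>

fun alpha :: "nat \<Rightarrow> nat" where
  "alpha n =
     (if n = 0 then 0
      else if n = 1 then 1
      else if n = 2 then 2
      else if n = 3 then 6
      else if n = 4 then 26
      else rho ((n + 1) div 2) (n div 2) * alpha ((n + 1) div 2))"

declare alpha.simps [simp del]

end

theory Submission imports Defs begin

text \<open>
  Summing differences recovers a gapless monotone triangle from its shape: the entry in
  position \<open>(i, j)\<close> is \<open>j\<close> plus the sum of the shape over rows \<open>i, i + 1, \<dots>, n\<close> of
  column \<open>j\<close>. The row inequalities of the triangle then say that these tail sums increase weakly
  from each column to the next, and the diagonal inequalities follow from these because a single
  entry of the shape is at most 1 (lemma \<open>gapless_shapes_eq\<close>). So a gapless shape is defined by the same
  condition as a rectangular one.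

  Since the condition concerns tail sums only, a triangle of size \<open>c\<close> can be put on top of a
  rectangle with \<open>c\<close> columns and \<open>p\<close> rows: tail sums that start in the triangle are
  sums of two tail sums, one from each part. The columns beyond \<open>c\<close> are filled with ones,
  which makes their tail sums as large as possible. Hence the numbers \<open>G n\<close> of gapless shapes
  satisfy \<open>G (c + p) \<ge> rho c p * G c\<close> (lemma \<open>card_gapless_shapes_add_ge\<close>), and this is the
  recursion of \<open>alpha\<close> when \<open>c\<close> and \<open>p\<close> are the two halves of \<open>n\<close>. As \<open>rho\<close> is positive, the
  strict inequality propagates. It holds at the start because a triangle whose rows all increase
  weakly is a gapless shape, and there are \<open>(n + 1)!\<close> of them
  (lemma \<open>fact_le_card_gapless_shapes\<close>).
\<close>

section \<open>Gapless shapes and tail sums\<close>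

definition tail_monotone_triangles :: "nat \<Rightarrow> (nat \<times> nat \<Rightarrow> int) set" where
  "tail_monotone_triangles n =
     {s \<in> tri n \<rightarrow>\<^sub>E {0, 1}.
        \<forall>i j. 1 \<le> j \<and> j < i \<and> i \<le> n \<longrightarrow>
          (\<Sum>k = i..n. s (k, j)) \<le> (\<Sum>k = i..n. s (k, j + 1))}"

lemma finite_tri: "finite (tri n)"
  by (rule finite_subset[of _ "{..n} \<times> {..n}"]) (auto simp: tri_def)

lemma finite_tail_monotone_triangles: "finite (tail_monotone_triangles n)"
  unfolding tail_monotone_triangles_def
  by (rule finite_subset[of _ "tri n \<rightarrow>\<^sub>E {0, 1}"]) (auto intro: finite_PiE finite_tri)

lemma tail_sum_shape:
  assumes "1 \<le> j" "j \<le> i" "i \<le> n + 1"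
  shows "(\<Sum>k = i..n. shape (n + 1) a (k, j)) = a (i, j) - a (n + 1, j)"
proof -
  have "(\<Sum>k = i..n. shape (n + 1) a (k, j)) = (\<Sum>k = i..n. a (k, j) - a (Suc k, j))"
    using assms by (intro sum.cong) (auto simp: shape_def tri_def)
  also have "\<dots> = - (\<Sum>k = i..n. a (Suc k, j) - a (k, j))"
    by (simp add: sum_negf[symmetric])
  also have "\<dots> = a (i, j) - a (n + 1, j)"
    using assms by (subst sum_Suc_diff[where f = "\<lambda>k. a (k, j)"]) auto
  finally show ?thesis .
qed

lemma shape_mem_tail_monotone_triangles:
  assumes "a \<in> gapless_monotone_triangles (n + 1)"
  shows "shape (n + 1) a \<in> tail_monotone_triangles n"
proof -
  have row: "a (i, j) < a (i, j + 1)" if "(i, j) \<in> tri (n + 1)" "(i, j + 1) \<in> tri (n + 1)" for i j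
    using assms that by (auto simp: gapless_monotone_triangles_def monotone_triangles_def)
  have column: "a (i + 1, j) \<le> a (i, j)" if "(i, j) \<in> tri n" for i j
  proof -
    have "(i + 1, j) \<in> tri (n + 1)" "(i + 1 - 1, j) \<in> tri (n + 1)"
      using that by (auto simp: tri_def)
    then have "a (i + 1, j) \<le> a (i + 1 - 1, j)"
      using assms unfolding gapless_monotone_triangles_def monotone_triangles_def by blast
    then show ?thesis by simp
  qed
  have gap: "a (i, j) - a (i + 1, j) \<le> 1" if "(i, j) \<in> tri n" for i j
    using assms that by (auto simp: gapless_monotone_triangles_def tri_def)
  have bottom: "a (n + 1, j) = int j" if "1 \<le> j" "j \<le> n + 1" for j
    using assms that by (simp add: gapless_monotone_triangles_def monotone_triangles_def)
  have "shape (n + 1) a (i, j) \<in> {0, 1}" if "(i, j) \<in> tri n" for i j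
    using column[OF that] gap[OF that] that by (auto simp: shape_def)
  moreover have "shape (n + 1) a \<in> extensional (tri n)"
    by (auto simp: shape_def)
  ultimately have "shape (n + 1) a \<in> tri n \<rightarrow>\<^sub>E {0, 1}"
    by (auto simp: PiE_def)
  moreover have "(\<Sum>k = i..n. shape (n + 1) a (k, j)) \<le> (\<Sum>k = i..n. shape (n + 1) a (k, j + 1))"
    if "1 \<le> j" "j < i" "i \<le> n" for i j
  proof -
    have "a (i, j) < a (i, j + 1)" using that by (intro row) (auto simp: tri_def)
    then show ?thesis
      using that bottom[of j] bottom[of "j + 1"]
        tail_sum_shape[of j i n a] tail_sum_shape[of "j + 1" i n a] by simp
  qed
  ultimately show ?thesis
    by (simp add: tail_monotone_triangles_def)
qed

text \<open>
  The only candidate for a preimage has the entries \<open>j\<close> plus a tail sum of \<open>s\<close>. Its diagonal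
  inequality comes from one step down, which loses at most 1, and one step to the right, which
  gains at least 1.
\<close>

lemma tail_monotone_triangle_is_shape:
  assumes "s \<in> tail_monotone_triangles n"
  shows "s \<in> gapless_shapes n"
proof -
  define S where "S i j = (\<Sum>k = i..n. s (k, j))" for i j
  define a where "a = (\<lambda>(i, j) \<in> tri (n + 1). int j + S i j)"
  have s01: "s (i, j) = 0 \<or> s (i, j) = 1" if "(i, j) \<in> tri n" for i j
    using assms that by (auto simp: tail_monotone_triangles_def)
  have S_row: "S i j \<le> S i (j + 1)" if "1 \<le> j" "j < i" for i j
    using assms that by (cases "i \<le> n") (auto simp: tail_monotone_triangles_def S_def)
  have S_step: "S i j = s (i, j) + S (i + 1) j" if "i \<le> n" for i j
    unfolding S_def by (simp add: sum.atLeast_Suc_atMost[OF that])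
  have S_nonneg: "0 \<le> S i j" if "1 \<le> j" "j \<le> i" for i j
    unfolding S_def
  proof (rule sum_nonneg)
    fix k assume "k \<in> {i..n}"
    then show "0 \<le> s (k, j)" using s01[of k j] that by (auto simp: tri_def)
  qed
  have a_eq: "a (i, j) = int j + S i j" if "1 \<le> j" "j \<le> i" "i \<le> n + 1" for i j
    using that by (simp add: a_def tri_def)
  have a_step: "a (i, j) = s (i, j) + a (i + 1, j)" "s (i, j) = 0 \<or> s (i, j) = 1"
    if "1 \<le> j" "j \<le> i" "i \<le> n" for i j
    using that S_step[of i j] s01[of i j] by (auto simp: a_eq tri_def)
  have "a \<in> tri (n + 1) \<rightarrow>\<^sub>E {1..}"
  proof (rule PiE_I)
    fix x assume "x \<in> tri (n + 1)"
    then obtain i j where x: "x = (i, j)" "1 \<le> j" "j \<le> i" "i \<le> n + 1"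
      by (auto simp: tri_def)
    then show "a x \<in> {1..}" using S_nonneg[of j i] by (simp add: a_eq)
  qed (auto simp: a_def)
  moreover have "a (i, j) < a (i, j + 1)"
    if "(i, j) \<in> tri (n + 1)" "(i, j + 1) \<in> tri (n + 1)" for i j
    using that S_row[of j i] by (simp add: tri_def a_eq)
  moreover have "a (i, j) \<le> a (i - 1, j)"
    if "(i, j) \<in> tri (n + 1)" "(i - 1, j) \<in> tri (n + 1)" for i j
  proof -
    have "1 \<le> j" "j \<le> i - 1" "i - 1 \<le> n" "i - 1 + 1 = i"
      using that by (auto simp: tri_def)
    then show ?thesis using a_step[of j "i - 1"] by auto
  qed
  moreover have "a (i, j) \<le> a (i + 1, j + 1)"
    if "(i, j) \<in> tri (n + 1)" "(i + 1, j + 1) \<in> tri (n + 1)" for i j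
  proof -
    have ij: "1 \<le> j" "j \<le> i" "i \<le> n" using that by (auto simp: tri_def)
    have "a (i, j) \<le> 1 + a (i + 1, j)" using a_step[OF ij] by auto
    also have "\<dots> \<le> a (i + 1, j + 1)" using ij S_row[of j "i + 1"] by (simp add: a_eq)
    finally show ?thesis .
  qed
  moreover have "a (n + 1, j) = int j" if "1 \<le> j \<and> j \<le> n + 1" for j
    using that by (simp add: a_eq S_def)
  ultimately have "a \<in> monotone_triangles (n + 1)"
    unfolding monotone_triangles_def by blast
  moreover have "a (i, j) - a (i + 1, j) \<le> 1" if "1 \<le> j \<and> j \<le> i \<and> i < n + 1" for i j
    using a_step[of j i] that by auto
  ultimately have "a \<in> gapless_monotone_triangles (n + 1)"
    unfolding gapless_monotone_triangles_def by blast
  moreover have "shape (n + 1) a = s"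
  proof
    fix x show "shape (n + 1) a x = s x"
    proof (cases "x \<in> tri n")
      case True
      then obtain i j where x: "x = (i, j)" "1 \<le> j" "j \<le> i" "i \<le> n"
        by (auto simp: tri_def)
      with True a_step(1)[of j i] show ?thesis by (simp add: shape_def)
    next
      case False
      moreover have "s \<in> extensional (tri n)"
        using assms by (auto simp: tail_monotone_triangles_def PiE_def)
      ultimately show ?thesis by (cases x) (simp add: shape_def extensional_def)
    qed
  qed
  ultimately show ?thesis
    unfolding gapless_shapes_def by blast
qed

lemma gapless_shapes_eq: "gapless_shapes n = tail_monotone_triangles n"
  using shape_mem_tail_monotone_triangles tail_monotone_triangle_is_shape
  by (auto simp: gapless_shapes_def)

section \<open>Gluing a rectangle below a triangle\<close>

text \<open>
  The rectangle occupies rows \<open>c + 1, \<dots>, c + p\<close> of columns \<open>1, \<dots>, c\<close>, directly below the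
  triangle, and the remaining triangle in the lower right corner consists of ones.
\<close>

definition glue :: "nat \<Rightarrow> nat \<Rightarrow> (nat \<times> nat \<Rightarrow> int) \<Rightarrow> (nat \<times> nat \<Rightarrow> int) \<Rightarrow> (nat \<times> nat \<Rightarrow> int)"
  where "glue c p r t =
    (\<lambda>(i, j) \<in> tri (c + p). if i \<le> c then t (i, j) else if j \<le> c then r (i - c, j) else 1)"

lemma tail_sum_glue_rect:
  assumes "1 \<le> j" "j \<le> c" "c < i"
  shows "(\<Sum>k = i..c + p. glue c p r t (k, j)) = (\<Sum>k = i - c..p. r (k, j))"
proof -
  have "(\<Sum>k = i..c + p. glue c p r t (k, j)) = (\<Sum>k = (i - c) + c..p + c. r (k - c, j))"
    using assms by (intro sum.cong) (auto simp: glue_def tri_def)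
  also have "\<dots> = (\<Sum>k = i - c..p. r (k, j))"
    by (subst sum.shift_bounds_cl_nat_ivl) simp
  finally show ?thesis .
qed

lemma tail_sum_glue_tri:
  assumes "1 \<le> j" "j \<le> i" "i \<le> c"
  shows "(\<Sum>k = i..c + p. glue c p r t (k, j)) = (\<Sum>k = i..c. t (k, j)) + (\<Sum>k = 1..p. r (k, j))"
proof -
  have "(\<Sum>k = i..c + p. glue c p r t (k, j))
      = (\<Sum>k = i..c. glue c p r t (k, j)) + (\<Sum>k = c + 1..c + p. glue c p r t (k, j))"
    using assms by (intro sum.ub_add_nat) simp
  also have "(\<Sum>k = i..c. glue c p r t (k, j)) = (\<Sum>k = i..c. t (k, j))"
    using assms by (intro sum.cong) (auto simp: glue_def tri_def)
  also have "(\<Sum>k = c + 1..c + p. glue c p r t (k, j)) = (\<Sum>k = 1..p. r (k, j))"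
    using assms by (subst tail_sum_glue_rect) auto
  finally show ?thesis .
qed

text \<open>
  Within the first \<open>c\<close> columns a tail sum belongs to the rectangle alone, or is a tail sum of
  the triangle plus the sum of a full column of the rectangle; both parts increase weakly with the
  column. From column \<open>c\<close> on, the next column is full of ones.
\<close>

lemma glue_mem_tail_monotone_triangles:
  assumes r: "r \<in> rect_gapless_shapes c p" and t: "t \<in> tail_monotone_triangles c"
  shows "glue c p r t \<in> tail_monotone_triangles (c + p)"
proof -
  let ?g = "glue c p r t"
  have r01: "r (i, j) \<in> {0, 1}" if "1 \<le> i" "i \<le> p" "1 \<le> j" "j \<le> c" for i j
    using r that by (auto simp: rect_gapless_shapes_def)
  have t01: "t (i, j) \<in> {0, 1}" if "(i, j) \<in> tri c" for i j
    using t that by (auto simp: tail_monotone_triangles_def)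
  have g01: "?g (i, j) \<in> {0, 1}" if "(i, j) \<in> tri (c + p)" for i j
    using that t01[of i j] r01[of "i - c" j] by (auto simp: glue_def tri_def)
  have "?g \<in> extensional (tri (c + p))"
    by (simp add: glue_def)
  with g01 have "?g \<in> tri (c + p) \<rightarrow>\<^sub>E {0, 1}"
    by (auto simp: PiE_def)
  moreover have "(\<Sum>k = i..c + p. ?g (k, j)) \<le> (\<Sum>k = i..c + p. ?g (k, j + 1))"
    if ij: "1 \<le> j" "j < i" "i \<le> c + p" for i j
  proof -
    have r_tail: "(\<Sum>k = l..p. r (k, j)) \<le> (\<Sum>k = l..p. r (k, j + 1))" if "1 \<le> l" "j < c" for l
      using r ij that by (cases "l \<le> p") (auto simp: rect_gapless_shapes_def)
    consider "c \<le> j" | "j < c" "c < i" | "j < c" "i \<le> c" by linarith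
    then show ?thesis
    proof cases
      case 1
      show ?thesis
      proof (rule sum_mono)
        fix k assume "k \<in> {i..c + p}"
        then show "?g (k, j) \<le> ?g (k, j + 1)"
          using g01[of k j] ij 1 by (auto simp: glue_def tri_def)
      qed
    next
      case 2
      then show ?thesis using ij r_tail[of "i - c"] by (simp add: tail_sum_glue_rect)
    next
      case 3
      have "(\<Sum>k = i..c. t (k, j)) \<le> (\<Sum>k = i..c. t (k, j + 1))"
        using t ij 3 by (simp add: tail_monotone_triangles_def)
      then show ?thesis
        using ij 3 r_tail[of 1] by (simp add: tail_sum_glue_tri del: One_nat_def)
    qed
  qed
  ultimately show ?thesis
    by (simp add: tail_monotone_triangles_def)
qed

lemma inj_on_glue:
  "inj_on (\<lambda>(r, t). glue c p r t) (rect_gapless_shapes c p \<times> tail_monotone_triangles c)"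
proof (rule inj_onI, clarify)
  fix r t r' t'
  assume r: "r \<in> rect_gapless_shapes c p" "r' \<in> rect_gapless_shapes c p"
    and t: "t \<in> tail_monotone_triangles c" "t' \<in> tail_monotone_triangles c"
    and eq: "glue c p r t = glue c p r' t'"
  have "r = r'"
  proof (rule PiE_ext[of _ "{1..p} \<times> {1..c}" "\<lambda>_. {0, 1}"])
    fix x assume x: "x \<in> {1..p} \<times> {1..c}"
    then show "r x = r' x"
      using fun_cong[OF eq, of "(c + fst x, snd x)"] by (auto simp: glue_def tri_def)
  qed (use r in \<open>auto simp: rect_gapless_shapes_def\<close>)
  moreover have "t = t'"
  proof (rule PiE_ext[of _ "tri c" "\<lambda>_. {0, 1}"])
    fix x assume "x \<in> tri c"
    then show "t x = t' x"
      using fun_cong[OF eq, of x] by (auto simp: glue_def tri_def)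
  qed (use t in \<open>auto simp: tail_monotone_triangles_def\<close>)
  ultimately show "r = r' \<and> t = t'" by simp
qed

lemma card_gapless_shapes_add_ge:
  "rho c p * card (gapless_shapes c) \<le> card (gapless_shapes (c + p))"
  unfolding rho_def gapless_shapes_eq card_cartesian_product[symmetric]
  by (rule card_inj_on_le[OF inj_on_glue])
     (auto intro: glue_mem_tail_monotone_triangles finite_tail_monotone_triangles)

lemma rho_pos: "0 < rho m p"
proof -
  have "(\<lambda>_ \<in> {1..p} \<times> {1..m}. 0) \<in> rect_gapless_shapes m p"
    by (auto simp: rect_gapless_shapes_def intro!: sum_mono)
  moreover have "finite (rect_gapless_shapes m p)"
    unfolding rect_gapless_shapes_def
    by (rule finite_subset[of _ "{1..p} \<times> {1..m} \<rightarrow>\<^sub>E {0, 1}"]) (auto intro: finite_PiE)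
  ultimately show ?thesis
    unfolding rho_def by (auto simp: card_gt_0_iff)
qed

section \<open>Triangles with weakly increasing rows\<close>

text \<open>
  Weakly increasing rows imply weakly increasing tail sums. A weakly increasing 0/1 row of
  length \<open>i\<close> is determined by its number \<open>f i \<in> {0, \<dots>, i}\<close> of zeros, which leaves \<open>i + 1\<close>
  choices for row \<open>i\<close>.
\<close>

lemma fact_le_card_gapless_shapes: "fact (n + 1) \<le> card (gapless_shapes n)"
proof -
  define rows where "rows = (PiE {1..n} (\<lambda>i. {0..i}))"
  define F :: "(nat \<Rightarrow> nat) \<Rightarrow> nat \<times> nat \<Rightarrow> int"
    where "F f = (\<lambda>(i, j) \<in> tri n. if f i < j then 1 else 0)" for f
  have "inj_on F rows"
  proof (rule inj_onI)
    fix f g assume fg: "f \<in> rows" "g \<in> rows" "F f = F g"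
    show "f = g"
    proof (rule PiE_ext[of _ "{1..n}" "\<lambda>i. {0..i}"])
      fix i assume i: "i \<in> {1..n}"
      have le: "f i \<le> i" "g i \<le> i" using fg i by (auto simp: rows_def)
      have F_eq: "f i < j \<longleftrightarrow> g i < j" if "1 \<le> j" "j \<le> i" for j
        using fun_cong[OF fg(3), of "(i, j)"] i that
        by (auto simp: F_def tri_def split: if_splits)
      \<comment> \<open>If \<open>f i\<close> and \<open>g i\<close> differ, the rows differ in the larger of the two columns.\<close>
      show "f i = g i"
        using F_eq[of "f i"] F_eq[of "g i"] le by linarith
    qed (use fg in \<open>auto simp: rows_def\<close>)
  qed
  moreover have "F ` rows \<subseteq> gapless_shapes n"
  proof (rule image_subsetI)
    fix f
    have "F f \<in> tri n \<rightarrow>\<^sub>E {0, 1}"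
      by (auto simp: F_def split: if_splits)
    moreover have "(\<Sum>k = i..n. F f (k, j)) \<le> (\<Sum>k = i..n. F f (k, j + 1))"
      if "1 \<le> j" "j < i" for i j
      using that by (intro sum_mono) (auto simp: F_def tri_def)
    ultimately show "F f \<in> gapless_shapes n"
      by (simp add: gapless_shapes_eq tail_monotone_triangles_def)
  qed
  ultimately have "card rows \<le> card (gapless_shapes n)"
    by (intro card_inj_on_le) (simp_all add: gapless_shapes_eq finite_tail_monotone_triangles)
  moreover have "card rows = (\<Prod>i = 1..n. Suc i)"
    by (simp add: rows_def card_PiE)
  moreover have "\<dots> = fact (n + 1)"
    by (induction n) (simp_all add: algebra_simps)
  ultimately show ?thesis by simp
qed

section \<open>The lower bound\<close>

theorem corollary3:
  fixes n :: nat
  assumes "n \<ge> 1"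
  shows "card (gapless_shapes n) > alpha n"
  using assms
proof (induction n rule: less_induct)
  case (less n)
  show ?case
  proof (cases "n \<le> 4")
    case True
    then consider "n = 1" | "n = 2" | "n = 3" | "n = 4" using less.prems by linarith
    then have "alpha n < fact (n + 1)"
      by cases (simp_all add: alpha.simps fact_numeral eval_nat_numeral)
    then show ?thesis using fact_le_card_gapless_shapes[of n] by linarith
  next
    case False
    define c where "c = (n + 1) div 2"
    define p where "p = n div 2"
    have c: "1 \<le> c" "c < n" "c + p = n" using False by (auto simp: c_def p_def)
    have "alpha n = rho c p * alpha c"
      using False by (subst alpha.simps) (simp add: c_def p_def)
    also have "\<dots> < rho c p * card (gapless_shapes c)"
      using less.IH[of c] c rho_pos[of c p] by simp
    also have "\<dots> \<le> card (gapless_shapes n)"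
      using card_gapless_shapes_add_ge[of c p] c by simp
    finally show ?thesis .
  qed
qed

end
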